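(* Let $n\ge 2$, let $(m_1,\dots,m_n)\in\mathbb{N}^n$ and assume that $\prod_{j\ne i}m_j\ge 2$ for all $i\in\{1,\dots,n\}$ (equivalently, all $m_i\geq 1$ and at least two players have at least two pure strategies). Then, within the set of $m_1\times\dots\times m_n$ games, the set of games whose correlated equilibrium polytope has dimension $m_1\times\dots\times m_n-2$ has Lebesgue measure $0$.
   Context: An $m_1\times\dots\times m_n$ game has player set $N=\{1,\dots,n\}$, pure strategy sets $C_i$ with $|C_i|=m_i$, $C=\prod_i C_i$, $C_{-i}=\prod_{j\neq i}C_j$, and utility functions $U_i:C\to\mathbb{R}$; the set of such games is identified with $\mathbb{R}^{n\,m_1\cdots m_n}$ through the payoffs, and is equipped with Lebesgue measure. A correlated equilibrium is a probability distribution $\mu\in\Delta(C)$ such that $\sum_{c_{-i}\in C_{-i}}\mu(c)[U_i(c_{-i},d_i)-U_i(c)]\le 0$ for all $i\in N$, $c_i,d_i\in C_i$ (where $c=(c_{-i},c_i)$). The set of correlated equilibria is a convex polytope in $\mathbb{R}^{|C|}$, the correlated equilibrium polytope; its dimension is the dimension of its affine hull. *)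

theory Defs
  imports "HOL-Analysis.Analysis"
begin

text \<open>
  Players are the elements of a finite type \<open>'n\<close>. All pure strategies are drawn from a finite
  type \<open>'s\<close>, and \<open>S i\<close> is the strategy set of player \<open>i\<close>, so the strategy sets may have
  different sizes. A common finite type makes \<open>'n \<Rightarrow> 's\<close> a finite type, so that it can index
  Euclidean vectors.
\<close>

definition profiles :: "('n \<Rightarrow> 's set) \<Rightarrow> ('n \<Rightarrow> 's) set"
  where "profiles S = Pi\<^sub>E UNIV S"

definition profiles_except :: "('n \<Rightarrow> 's set) \<Rightarrow> 'n \<Rightarrow> ('n \<Rightarrow> 's) set"
  where "profiles_except S i = Pi\<^sub>E (UNIV - {i}) S"

text \<open>
  A game is its family of payoffs: \<open>U (i, c)\<close> is the utility of player \<open>i\<close> at profile \<open>c\<close>.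
  Outside of \<open>UNIV \<times> profiles S\<close> it takes the value \<open>undefined\<close>, so the payoffs at the
  profiles are its only coordinates.
\<close>

type_synonym ('n, 's) game = "'n \<times> ('n \<Rightarrow> 's) \<Rightarrow> real"

definition games :: "('n \<Rightarrow> 's set) \<Rightarrow> ('n, 's) game set"
  where "games S = (UNIV \<times> profiles S) \<rightarrow>\<^sub>E UNIV"

text \<open>
  The product of one copy of \<^const>\<open>lborel\<close> per payoff is Lebesgue measure on the Borel sets;
  its completion is Lebesgue measure on all Lebesgue measurable sets.
\<close>

definition game_lebesgue :: "('n::finite \<Rightarrow> 's::finite set) \<Rightarrow> ('n, 's) game measure"
  where "game_lebesgue S = completion (Pi\<^sub>M (UNIV \<times> profiles S) (\<lambda>_. lborel))"

lemma space_game_lebesgue: "space (game_lebesgue S) = games S"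
  by (simp add: game_lebesgue_def games_def space_PiM)

text \<open>
  Vectors indexed by \<^term>\<open>profiles S\<close> are represented as the vectors indexed by all of
  \<open>'n \<Rightarrow> 's\<close> that vanish off \<^term>\<open>profiles S\<close>; this is a coordinate subspace, so affine
  dimensions are not affected.
\<close>

definition distributions :: "('n::finite \<Rightarrow> 's::finite set) \<Rightarrow> (real ^ ('n \<Rightarrow> 's)) set"
  where "distributions S =
    {\<mu>. (\<forall>c\<in>profiles S. 0 \<le> \<mu> $ c) \<and> (\<forall>c. c \<notin> profiles S \<longrightarrow> \<mu> $ c = 0) \<and>
        (\<Sum>c\<in>profiles S. \<mu> $ c) = 1}"

definition correlated_equilibria ::
    "('n::finite \<Rightarrow> 's::finite set) \<Rightarrow> ('n, 's) game \<Rightarrow> (real ^ ('n \<Rightarrow> 's)) set"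
  where "correlated_equilibria S U =
    {\<mu> \<in> distributions S. \<forall>i. \<forall>a\<in>S i. \<forall>d\<in>S i.
      (\<Sum>c\<in>profiles_except S i. \<mu> $ (c(i := a)) * (U (i, c(i := d)) - U (i, c(i := a)))) \<le> 0}"

end

theory Submission
  imports Defs
begin

text \<open>
  The correlated equilibrium polytope is cut out of the affine hyperplane of total mass 1 in
  \<open>\<real>\<^sup>C\<close> by finitely many homogeneous inequalities \<open>g \<bullet> \<mu> \<le> 0\<close>: one for the sign of each coordinate
  and one for each deviation of a player \<open>i\<close> from a strategy \<open>a\<close> to another strategy \<open>d\<close>.
  Suppose that it has dimension \<open>|C| - 2\<close>, one less than the simplex. All
  inequalities that hold with equality on the whole polytope then have normals that are multiples
  of a single vector \<open>f\<close>. If these multiples all had the same sign, one could move from a relative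
  interior point slightly to the side of the hyperplane \<open>f \<bullet> \<mu> = 0\<close> where these inequalities
  become strict, without violating any other inequality, and would find an equilibrium off the
  hyperplane. So two of the normals are
  negative multiples of one another (\<open>opposite_constraints_of_codim_one\<close>).

  For almost every game this is impossible. The normal of the deviation from \<open>a\<close> to \<open>d\<close> has the
  payoff differences \<open>U\<^sub>i(b, d) - U\<^sub>i(b, a)\<close> as its entries. If no such difference vanishes, its
  support is the set of all profiles in which \<open>i\<close> plays \<open>a\<close>. That set has at least two elements, so it
  is not the support of a sign constraint, and it determines \<open>i\<close> and \<open>a\<close>. Two proportional normals
  therefore belong to deviations of the same player from the same strategy, to some \<open>d \<noteq> e\<close>, and
  proportionality at two profiles \<open>b \<noteq> b'\<close> of the opponents is one polynomial equation between
  payoffs (\<open>generic_no_opposite_constraints\<close>). Each exceptional equation expresses one payoff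
  as a function of the others, so by Fubini it holds on a null set only
  (\<open>null_sets_PiM_graph\<close>), and there are finitely many of them.
\<close>

section \<open>Polyhedra of codimension one\<close>

text \<open>
  This point is a substitute for one in the relative interior. It is built by averaging: the
  midpoint of a point where \<open>g\<close> is strict and a point where the inequalities treated before are
  strict inherits strictness from both, because all inequalities hold weakly on \<open>P\<close>.
\<close>

lemma convex_common_strict_point:
  fixes P :: "'a::real_inner set"
  assumes "convex P" "P \<noteq> {}" "finite G" and le: "\<And>g x. g \<in> G \<Longrightarrow> x \<in> P \<Longrightarrow> g \<bullet> x \<le> 0"
  shows "\<exists>p\<in>P. \<forall>g\<in>G. (\<exists>x\<in>P. g \<bullet> x < 0) \<longrightarrow> g \<bullet> p < 0"
  using \<open>finite G\<close> le
proof (induction G rule: finite_induct)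
  case empty
  then show ?case using \<open>P \<noteq> {}\<close> by auto
next
  case (insert g G)
  then obtain p where p: "p \<in> P" "\<forall>h\<in>G. (\<exists>x\<in>P. h \<bullet> x < 0) \<longrightarrow> h \<bullet> p < 0"
    by auto
  show ?case
  proof (cases "\<exists>x\<in>P. g \<bullet> x < 0")
    case False
    then show ?thesis using p by auto
  next
    case True
    then obtain x where x: "x \<in> P" "g \<bullet> x < 0" by auto
    define q where "q = (1/2) *\<^sub>R p + (1/2) *\<^sub>R x"
    have "q \<in> P"
      unfolding q_def using \<open>convex P\<close> p(1) x(1) by (intro convexD) auto
    have q: "h \<bullet> q = (h \<bullet> p + h \<bullet> x) / 2" for h
      by (simp add: q_def inner_add_right add_divide_distrib)
    have "g \<bullet> q < 0" using insert.prems[of g p] p(1) x(2) q[of g] by simp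
    moreover have "h \<bullet> q < 0" if h: "h \<in> G" "\<exists>y\<in>P. h \<bullet> y < 0" for h
    proof -
      have "h \<bullet> p < 0" using p(2) h by blast
      then show ?thesis using insert.prems[of h x] x(1) h(1) q[of h] by simp
    qed
    ultimately show ?thesis using \<open>q \<in> P\<close> by auto
  qed
qed

text \<open>
  The normalisation \<open>s \<bullet> x = 1\<close> keeps the origin out of the affine hull of \<open>P\<close>, so the linear span of
  \<open>P\<close> has codimension 1 in \<open>V\<close>, and its orthogonal complement in \<open>V\<close> is a line spanned by some \<open>f\<close>.
  If all \<open>g \<in> G\<close> that vanish on \<open>P\<close> had a negative product with \<open>v\<close>, where \<open>v\<close> is \<open>f\<close> or \<open>- f\<close>, then
  moving a little along \<open>v\<close> from a point where the other constraints are strict, and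
  rescaling, would give a point of \<open>P\<close> that is not orthogonal to \<open>f\<close>. Applied to
  both signs of \<open>v\<close>, this yields two multiples of \<open>f\<close> in \<open>G\<close> with coefficients of opposite sign.
\<close>

lemma opposite_constraints_of_codim_one:
  fixes V G :: "'a::euclidean_space set" and s :: 'a
  defines "P \<equiv> {x \<in> V. s \<bullet> x = 1 \<and> (\<forall>g\<in>G. g \<bullet> x \<le> 0)}"
  assumes V: "subspace V" and G: "finite G" "G \<subseteq> V" "0 \<notin> G"
    and ne: "P \<noteq> {}" and codim: "aff_dim P = int (dim V) - 2"
  shows "\<exists>g\<in>G. \<exists>h\<in>G. \<exists>r>0. g = - r *\<^sub>R h"
proof -
  have PV: "P \<subseteq> V" by (auto simp: P_def)
  have "convex V" using V by (rule subspace_imp_convex)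
  then have "convex (V \<inter> {x. s \<bullet> x = 1} \<inter> (\<Inter>g\<in>G. {x. g \<bullet> x \<le> 0}))"
    by (intro convex_Int convex_INT ballI convex_hyperplane convex_halfspace_le)
  also have "\<dots> = P" by (auto simp: P_def)
  finally have "convex P" .
  have "affine hull P \<subseteq> {x. s \<bullet> x = 1}"
    by (rule hull_minimal) (auto simp: P_def affine_hyperplane)
  then have "0 \<notin> affine hull P" by auto
  then have "aff_dim (insert 0 P) = aff_dim P + 1"
    by (simp add: aff_dim_insert)
  moreover have "dim (insert 0 P) = dim P" by (metis dim_span span_insert_0)
  ultimately have dimP: "int (dim P) = int (dim V) - 1"
    using codim by (simp add: aff_dim_zero hull_inc)
  define W where "W = {y \<in> V. \<forall>x\<in>span P. orthogonal x y}"
  have "dim W + dim (span P) = dim V"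
    unfolding W_def using PV V
    by (intro dim_subspace_orthogonal_to_vectors) (auto simp: span_minimal)
  then have "dim W = 1" using dimP by simp
  have "subspace W"
    unfolding W_def using V
    by (auto simp: subspace_def orthogonal_def inner_add_right)
  obtain B where B: "B \<subseteq> W" "independent B" "W \<subseteq> span B" "card B = dim W"
    by (rule basis_exists)
  then obtain f where "B = {f}" using \<open>dim W = 1\<close> by (auto simp: card_1_singleton_iff)
  then have "f \<noteq> 0" and W: "W = span {f}"
    using B \<open>subspace W\<close> span_minimal[of B W] by auto
  then have "f \<in> W" by (simp add: span_base)
  then have f: "f \<in> V" "\<And>x. x \<in> P \<Longrightarrow> f \<bullet> x = 0"
    by (auto simp: W_def orthogonal_def span_base inner_commute[of f])
  have multiple: "\<exists>k. k \<noteq> 0 \<and> g = k *\<^sub>R f" if "g \<in> G" "\<And>x. x \<in> P \<Longrightarrow> g \<bullet> x = 0" for g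
  proof -
    have "orthogonal x g" if "x \<in> span P" for x
      using orthogonal_to_span[OF that, of g] \<open>\<And>x. x \<in> P \<Longrightarrow> g \<bullet> x = 0\<close>
      by (simp add: orthogonal_def inner_commute)
    then have "g \<in> W" using that(1) G(2) by (auto simp: W_def)
    then obtain k where "g = k *\<^sub>R f" by (auto simp: W span_singleton)
    then show ?thesis using that(1) G(3) by (metis scale_zero_left)
  qed
  obtain p where p: "p \<in> P" and strict: "\<forall>g\<in>G. (\<exists>x\<in>P. g \<bullet> x < 0) \<longrightarrow> g \<bullet> p < 0"
    using convex_common_strict_point[OF \<open>convex P\<close> ne G(1)] by (auto simp: P_def)
  have blocking: "\<exists>g\<in>G. (\<forall>x\<in>P. g \<bullet> x = 0) \<and> g \<bullet> v \<ge> 0" if v: "v \<in> V" "f \<bullet> v \<noteq> 0" for v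
  proof (rule ccontr)
    assume neg: "\<not> ?thesis"
    have lim: "((\<lambda>e. g \<bullet> (p + e *\<^sub>R v)) \<longlongrightarrow> g \<bullet> (p + 0 *\<^sub>R v)) (at_right 0)" for g
      by (intro tendsto_intros)
    have "\<forall>\<^sub>F e in at_right 0. g \<bullet> (p + e *\<^sub>R v) < 0" if g: "g \<in> G" for g
    proof (cases "\<forall>x\<in>P. g \<bullet> x = 0")
      case True
      then have "g \<bullet> p = 0" "g \<bullet> v < 0" using neg g p by auto
      then show ?thesis
        by (auto simp: inner_add_right mult_less_0_iff eventually_at_right_less
            intro: eventually_mono[OF eventually_at_right_less[of 0]])
    next
      case False
      then have "g \<bullet> p < 0" using strict g by (force simp: P_def)
      then show ?thesis using order_tendstoD(2)[OF lim[of g], of 0] by simp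
    qed
    then have "\<forall>\<^sub>F e in at_right 0. \<forall>g\<in>G. g \<bullet> (p + e *\<^sub>R v) < 0"
      using G(1) by (intro eventually_ball_finite) auto
    moreover have "\<forall>\<^sub>F e in at_right 0. s \<bullet> (p + e *\<^sub>R v) > 0"
      using order_tendstoD(1)[OF lim[of s], of 0] p by (simp add: P_def)
    moreover have "\<forall>\<^sub>F e in at_right (0::real). e > 0" by (rule eventually_at_right_less)
    ultimately have "\<forall>\<^sub>F e in at_right 0.
        (\<forall>g\<in>G. g \<bullet> (p + e *\<^sub>R v) < 0) \<and> s \<bullet> (p + e *\<^sub>R v) > 0 \<and> e > 0"
      by eventually_elim auto
    then obtain e where e: "\<forall>g\<in>G. g \<bullet> (p + e *\<^sub>R v) < 0" "s \<bullet> (p + e *\<^sub>R v) > 0" "e > 0"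
      using eventually_happens'[OF trivial_limit_at_right_real] by blast
    define q where "q = p + e *\<^sub>R v"
    have "q \<in> V" using p v V by (auto simp: q_def P_def subspace_add subspace_scale)
    then have "(1 / (s \<bullet> q)) *\<^sub>R q \<in> P"
      using e V by (auto simp: P_def q_def[symmetric] subspace_scale divide_le_0_iff less_imp_le)
    then have "f \<bullet> q = 0" using f(2) e(2) by (fastforce simp: q_def[symmetric])
    then show False using f(2)[OF p] v(2) e(3) by (simp add: q_def inner_add_right)
  qed
  have "f \<bullet> f > 0" using \<open>f \<noteq> 0\<close> by simp
  obtain g where g: "g \<in> G" "\<forall>x\<in>P. g \<bullet> x = 0" "g \<bullet> f \<ge> 0"
    using blocking[of f] f(1) \<open>f \<bullet> f > 0\<close> by auto
  obtain h where h: "h \<in> G" "\<forall>x\<in>P. h \<bullet> x = 0" "h \<bullet> (- f) \<ge> 0"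
    using blocking[of "- f"] f(1) \<open>f \<bullet> f > 0\<close> V by (auto simp: subspace_neg)
  obtain k where k: "k \<noteq> 0" "g = k *\<^sub>R f" using multiple[of g] g by auto
  obtain l where l: "l \<noteq> 0" "h = l *\<^sub>R f" using multiple[of h] h by auto
  have "k > 0" using g(3) k \<open>f \<bullet> f > 0\<close> by (simp add: zero_le_mult_iff)
  moreover have "l < 0" using h(3) l \<open>f \<bullet> f > 0\<close> by (simp add: mult_le_0_iff)
  ultimately have "- (k / l) > 0" "g = - (- (k / l)) *\<^sub>R h"
    using k l by (auto simp: divide_neg_pos divide_pos_neg)
  then show ?thesis using g(1) h(1) by blast
qed

section \<open>Coordinates determined by the other coordinates\<close>

text \<open>
  Every line in the direction of the coordinate \<open>k\<close> meets this set in at most one point, since \<open>F\<close>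
  is constant along it.
\<close>

lemma null_sets_PiM_graph:
  fixes F :: "('i \<Rightarrow> real) \<Rightarrow> real"
  assumes "finite I" "k \<in> I"
    and F: "F \<in> borel_measurable (Pi\<^sub>M I (\<lambda>_. lborel))"
    and indep: "\<And>x t. F (x(k := t)) = F x"
  shows "{x \<in> space (Pi\<^sub>M I (\<lambda>_. lborel)). x k = F x} \<in> null_sets (Pi\<^sub>M I (\<lambda>_. lborel))"
    (is "?A \<in> null_sets ?M")
proof -
  interpret product_sigma_finite "\<lambda>_::'i. lborel :: real measure" ..
  define J where "J = I - {k}"
  have J: "finite J" "k \<notin> J" "I = insert k J" using assms(1,2) by (auto simp: J_def)
  have k: "(\<lambda>x. x k) \<in> borel_measurable ?M"
    using measurable_component_singleton[OF \<open>k \<in> I\<close>, of "\<lambda>_. lborel"] by simp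
  have A: "?A \<in> sets ?M"
    using k F by (rule borel_measurable_eq)
  have "emeasure ?M ?A = (\<integral>\<^sup>+ x. indicator ?A x \<partial>?M)"
    using A by simp
  also have "\<dots> = (\<integral>\<^sup>+ x. (\<integral>\<^sup>+ t. indicator ?A (x(k := t)) \<partial>lborel) \<partial>Pi\<^sub>M J (\<lambda>_. lborel))"
    using A unfolding J(3) by (intro product_nn_integral_insert J) auto
  also have "\<dots> \<le> (\<integral>\<^sup>+ x. (\<integral>\<^sup>+ t. indicator {F x} t \<partial>lborel) \<partial>Pi\<^sub>M J (\<lambda>_. lborel))"
    by (intro nn_integral_mono) (auto simp: indep split: split_indicator)
  also have "\<dots> = 0" by simp
  finally show ?thesis using A by auto
qed

section \<open>Incentive constraints as vectors\<close>

text \<open>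
  This is the normal vector of an incentive constraint: its inner product with \<open>\<mu>\<close> is the left-hand
  side of the equilibrium condition for player \<open>i\<close> told to play \<open>a\<close> and considering \<open>d\<close>.
\<close>

definition deviation_gain :: "('n::finite \<Rightarrow> 's::finite set) \<Rightarrow> ('n, 's) game \<Rightarrow> 'n \<Rightarrow> 's \<Rightarrow> 's
    \<Rightarrow> real ^ ('n \<Rightarrow> 's)"
  where "deviation_gain S U i a d =
    (\<chi> c. if c \<in> profiles S \<and> c i = a then U (i, c(i := d)) - U (i, c) else 0)"

lemma fun_upd_profiles_except:
  assumes "b \<in> profiles_except S i" "a \<in> S i"
  shows "b(i := a) \<in> profiles S"
  using assms by (auto simp: profiles_def profiles_except_def PiE_iff)

lemma fun_upd_profiles_except_inject:
  assumes "b \<in> profiles_except S i" "b' \<in> profiles_except S i" "b(i := a) = b'(i := a)"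
  shows "b = b'"
proof
  fix j
  show "b j = b' j"
    using assms(1,2) fun_cong[OF assms(3), of j]
    by (cases "j = i") (auto simp: profiles_except_def PiE_iff extensional_def simp del: fun_upd_apply, simp)
qed

lemma fun_upd_profiles:
  assumes "c \<in> profiles S" "a \<in> S i"
  shows "c(i := a) \<in> profiles S"
  using assms by (auto simp: profiles_def PiE_iff)

lemma deviation_gain_nth:
  assumes "b \<in> profiles_except S i" "a \<in> S i"
  shows "deviation_gain S U i a d $ (b(i := a)) = U (i, b(i := d)) - U (i, b(i := a))"
  using fun_upd_profiles_except[OF assms] by (simp add: deviation_gain_def)

lemma inner_deviation_gain:
  assumes "a \<in> S i"
  shows "deviation_gain S U i a d \<bullet> \<mu> =
    (\<Sum>c\<in>profiles_except S i. \<mu> $ (c(i := a)) * (U (i, c(i := d)) - U (i, c(i := a))))"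
proof -
  have "deviation_gain S U i a d \<bullet> \<mu> =
      (\<Sum>c\<in>{c \<in> profiles S. c i = a}. deviation_gain S U i a d $ c * \<mu> $ c)"
    unfolding inner_vec_def inner_real_def
    by (rule sum.mono_neutral_right) (auto simp: deviation_gain_def)
  also have "\<dots> = (\<Sum>c\<in>profiles_except S i. \<mu> $ (c(i := a)) * (U (i, c(i := d)) - U (i, c(i := a))))"
    by (rule sum.reindex_bij_witness[of _ "\<lambda>c. c(i := a)" "\<lambda>c. c(i := undefined)"])
      (use assms in \<open>auto simp: deviation_gain_def profiles_def profiles_except_def PiE_iff
         extensional_def fun_upd_idem\<close>)
  finally show ?thesis .
qed

text \<open>
  Trivial deviations from \<open>a\<close> to \<open>a\<close> are left out because their normal vector is 0, which is its own
  negative multiple.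
\<close>

definition constraints :: "('n::finite \<Rightarrow> 's::finite set) \<Rightarrow> ('n, 's) game \<Rightarrow> (real ^ ('n \<Rightarrow> 's)) set"
  where "constraints S U = (\<lambda>c. - axis c 1) ` profiles S \<union>
    {deviation_gain S U i a d | i a d. a \<in> S i \<and> d \<in> S i \<and> a \<noteq> d}"

lemma correlated_equilibria_eq:
  "correlated_equilibria S U =
    {\<mu> \<in> {\<mu>. \<forall>c. c \<notin> profiles S \<longrightarrow> \<mu> $ c = 0}. (\<chi> c. 1) \<bullet> \<mu> = 1 \<and> (\<forall>g\<in>constraints S U. g \<bullet> \<mu> \<le> 0)}"
proof -
  have total: "(\<chi> c. 1) \<bullet> \<mu> = (\<Sum>c\<in>profiles S. \<mu> $ c)"
    if "\<forall>c. c \<notin> profiles S \<longrightarrow> \<mu> $ c = 0" for \<mu> :: "real ^ ('a \<Rightarrow> 'b)"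
    unfolding inner_vec_def by (rule sum.mono_neutral_cong_right) (use that in auto)
  have trivial: "deviation_gain S U i a a = 0" for i a
    by (auto simp: deviation_gain_def vec_eq_iff)
  have "(\<forall>g\<in>constraints S U. g \<bullet> \<mu> \<le> 0) \<longleftrightarrow>
      (\<forall>c\<in>profiles S. 0 \<le> \<mu> $ c) \<and> (\<forall>i. \<forall>a\<in>S i. \<forall>d\<in>S i. deviation_gain S U i a d \<bullet> \<mu> \<le> 0)" for \<mu>
  proof
    assume *: "\<forall>g\<in>constraints S U. g \<bullet> \<mu> \<le> 0"
    have "deviation_gain S U i a d \<bullet> \<mu> \<le> 0" if "a \<in> S i" "d \<in> S i" for i a d
      using * that by (cases "a = d") (auto simp: trivial constraints_def)
    moreover have "0 \<le> \<mu> $ c" if "c \<in> profiles S" for c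
      using *[rule_format, of "- axis c 1"] that by (simp add: constraints_def inner_axis')
    ultimately show "(\<forall>c\<in>profiles S. 0 \<le> \<mu> $ c) \<and>
        (\<forall>i. \<forall>a\<in>S i. \<forall>d\<in>S i. deviation_gain S U i a d \<bullet> \<mu> \<le> 0)"
      by blast
  qed (auto simp: constraints_def inner_axis')
  then show ?thesis
    by (auto simp: correlated_equilibria_def distributions_def total inner_deviation_gain)
qed

section \<open>Games without opposite constraints\<close>

text \<open>
  The second condition says that the vectors of gains from deviating from \<open>a\<close> to \<open>d\<close> and from \<open>a\<close>
  to \<open>e\<close> are linearly independent, as witnessed by any two opponents' profiles \<open>b\<close> and \<open>b'\<close>.
  It is solved for the payoff at \<open>(b, e)\<close>, which occurs nowhere else in it, so that its failure
  makes that payoff a function of the other payoffs. The division is legitimate by the first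
  condition.
\<close>

definition generic :: "('n \<Rightarrow> 's set) \<Rightarrow> ('n, 's) game \<Rightarrow> bool"
  where "generic S U \<longleftrightarrow>
    (\<forall>i. \<forall>b\<in>profiles_except S i. \<forall>a\<in>S i. \<forall>d\<in>S i. a \<noteq> d \<longrightarrow> U (i, b(i := a)) \<noteq> U (i, b(i := d))) \<and>
    (\<forall>i. \<forall>b\<in>profiles_except S i. \<forall>b'\<in>profiles_except S i. \<forall>a\<in>S i. \<forall>d\<in>S i. \<forall>e\<in>S i.
      b \<noteq> b' \<longrightarrow> a \<noteq> d \<longrightarrow> a \<noteq> e \<longrightarrow> d \<noteq> e \<longrightarrow>
      U (i, b(i := e)) \<noteq> U (i, b(i := a)) +
        (U (i, b(i := d)) - U (i, b(i := a))) * (U (i, b'(i := e)) - U (i, b'(i := a)))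
          / (U (i, b'(i := d)) - U (i, b'(i := a))))"

lemma deviation_gain_support:
  assumes "generic S U" "a \<in> S i" "d \<in> S i" "a \<noteq> d"
  shows "deviation_gain S U i a d $ c \<noteq> 0 \<longleftrightarrow> c \<in> profiles S \<and> c i = a"
proof -
  have "U (i, c(i := d)) \<noteq> U (i, c)" if "c \<in> profiles S" "c i = a"
  proof -
    define b where "b = c(i := undefined)"
    have "b \<in> profiles_except S i" "b(i := a) = c" "b(i := d) = c(i := d)"
      using that by (auto simp: b_def profiles_def profiles_except_def PiE_iff extensional_def)
    then show ?thesis using assms unfolding generic_def by metis
  qed
  then show ?thesis by (auto simp: deviation_gain_def)
qed

text \<open>
  Proportional vectors have equal supports. The support of a sign constraint is a single profile,
  that of a deviation from \<open>a\<close> by \<open>i\<close> consists of at least two, which excludes a mixed pair and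
  identifies \<open>i\<close> and \<open>a\<close> in a pair of deviations. A remaining pair with the same target is excluded
  by the sign of \<open>r\<close>, one with different targets by the second condition of genericity.
\<close>

lemma generic_no_opposite_constraints:
  assumes gen: "generic S U" and two: "\<And>i. card (profiles_except S i) \<ge> 2"
    and ne: "profiles S \<noteq> {}"
    and g: "g \<in> constraints S U" and h: "h \<in> constraints S U" and r: "r > 0"
  shows "g \<noteq> - r *\<^sub>R h"
proof
  assume eq: "g = - r *\<^sub>R h"
  have nth: "g $ c = - r * h $ c" for c using eq by simp
  have supp: "g $ c \<noteq> 0 \<longleftrightarrow> h $ c \<noteq> 0" for c using nth r by simp
  have pair: "\<exists>b\<in>profiles_except S i. \<exists>b'\<in>profiles_except S i. b \<noteq> b'" for i
    using two[of i] by (auto simp: numeral_2_eq_2 card_le_Suc_iff)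
  have not_axis: False
    if "a \<in> S i" "d \<in> S i" "a \<noteq> d"
      and same_support: "\<And>x. deviation_gain S U i a d $ x \<noteq> 0 \<longleftrightarrow> (- axis c 1 :: real ^ ('a \<Rightarrow> 'b)) $ x \<noteq> 0" for i a d c
  proof -
    obtain b b' where b: "b \<in> profiles_except S i" "b' \<in> profiles_except S i" "b \<noteq> b'"
      using pair by blast
    have "x = c" if "x \<in> profiles S" "x i = a" for x
      using that same_support[of x] deviation_gain_support[OF gen \<open>a \<in> S i\<close> \<open>d \<in> S i\<close> \<open>a \<noteq> d\<close>]
      by (auto simp: axis_def split: if_splits)
    then have "b(i := a) = b'(i := a)"
      using fun_upd_profiles_except \<open>a \<in> S i\<close> b by (metis fun_upd_same)
    then show False using fun_upd_profiles_except_inject b by metis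
  qed
  consider (axes) c c' where "g = - axis c 1" "h = - axis c' 1"
    | (left) c i a d where "h = - axis c 1" "g = deviation_gain S U i a d" "a \<in> S i" "d \<in> S i" "a \<noteq> d"
    | (right) c i a d where "g = - axis c 1" "h = deviation_gain S U i a d" "a \<in> S i" "d \<in> S i" "a \<noteq> d"
    | (gains) i a d j a' e where "g = deviation_gain S U i a d" "a \<in> S i" "d \<in> S i" "a \<noteq> d"
        "h = deviation_gain S U j a' e" "a' \<in> S j" "e \<in> S j" "a' \<noteq> e"
    using g h unfolding constraints_def by blast
  then show False
  proof cases
    case axes
    then show False using nth[of c] r by (auto simp: axis_def split: if_splits)
  next
    case left
    then show False using not_axis[of a i d c] supp by blast
  next
    case right
    then show False using not_axis[of a i d c] supp by blast
  next
    case gains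
    have same: "x i = a \<longleftrightarrow> x j = a'" if "x \<in> profiles S" for x
      using supp[of x] that gains deviation_gain_support[OF gen] by metis
    obtain c where c: "c \<in> profiles S" using ne by blast
    have "i = j"
    \<comment> \<open>Otherwise the first player can be held at \<open>a\<close> while the second plays \<open>e\<close> instead of \<open>a'\<close>,
      and such a profile lies in only one of the two supports.\<close>
    proof (rule ccontr)
      assume "i \<noteq> j"
      then show False
        using same[of "c(i := a, j := e)"] c gains by (simp add: fun_upd_profiles)
    qed
    then have "a = a'" using same[of "c(i := a)"] c gains by (simp add: fun_upd_profiles)
    obtain b b' where b: "b \<in> profiles_except S i" "b' \<in> profiles_except S i" "b \<noteq> b'"
      using pair by blast
    define X where "X b = U (i, b(i := d)) - U (i, b(i := a))" for b
    define Y where "Y b = U (i, b(i := e)) - U (i, b(i := a))" for b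
    have XY: "X b = - r * Y b" if "b \<in> profiles_except S i" for b
      using nth[of "b(i := a)"] that gains \<open>i = j\<close> \<open>a = a'\<close>
      by (simp add: deviation_gain_nth X_def Y_def)
    have X: "X b' \<noteq> 0"
      using gen b gains unfolding generic_def X_def by force
    have "d \<noteq> e"
    proof
      assume "d = e"
      then have "X b' * (1 + r) = 0" using XY[OF b(2)] by (simp add: X_def Y_def algebra_simps)
      then show False using X r by simp
    qed
    have "Y b = X b * Y b' / X b'"
      using X XY b by simp
    then have "U (i, b(i := e)) = U (i, b(i := a)) + X b * Y b' / X b'"
      by (simp add: Y_def)
    then show False
      using gen b gains \<open>i = j\<close> \<open>a = a'\<close> \<open>d \<noteq> e\<close> unfolding generic_def X_def Y_def by blast
  qed
qed

lemma generic_aff_dim: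
  assumes gen: "generic S U" and two: "\<And>i. card (profiles_except S i) \<ge> 2"
    and card: "card (profiles S) \<ge> 2"
  shows "aff_dim (correlated_equilibria S U) \<noteq> int (card (profiles S)) - 2"
proof
  assume dim: "aff_dim (correlated_equilibria S U) = int (card (profiles S)) - 2"
  define V where "V = {\<mu> :: real ^ ('a \<Rightarrow> 'b). \<forall>c. c \<notin> profiles S \<longrightarrow> \<mu> $ c = 0}"
  have V: "subspace V" by (auto simp: subspace_def V_def)
  have dimV: "dim V = card (profiles S)"
    unfolding V_def using dim_substandard_cart[where ?'a = real, of "profiles S"] by (simp add: dim_vec_eq)
  have "{deviation_gain S U i a d | i a d. a \<in> S i \<and> d \<in> S i \<and> a \<noteq> d} \<subseteq>
      (\<lambda>(i, a, d). deviation_gain S U i a d) ` UNIV"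
    by (auto intro!: rev_image_eqI[where x = "(_, _, _)"])
  then have fin: "finite (constraints S U)"
    unfolding constraints_def
    by (intro finite_UnI finite_imageI finite) (erule finite_subset, intro finite_imageI finite)
  have sub: "constraints S U \<subseteq> V"
    by (auto simp: constraints_def V_def deviation_gain_def axis_def)
  have ne: "profiles S \<noteq> {}" using card by auto
  \<comment> \<open>A zero vector would be opposite to itself.\<close>
  have "g \<noteq> 0" if "g \<in> constraints S U" for g
    using generic_no_opposite_constraints[OF gen two ne that that, of 1] by auto
  then have zero: "0 \<notin> constraints S U" by blast
  have "aff_dim (correlated_equilibria S U) \<ge> 0" using dim card by simp
  then have "correlated_equilibria S U \<noteq> {}" by auto
  then have "\<exists>g\<in>constraints S U. \<exists>h\<in>constraints S U. \<exists>r>0. g = - r *\<^sub>R h"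
    using dim dimV opposite_constraints_of_codim_one[OF V fin sub zero, of "\<chi> c. 1"]
    by (simp add: correlated_equilibria_eq V_def)
  then show False using generic_no_opposite_constraints[OF gen two ne] by blast
qed

section \<open>Almost all games are generic\<close>

lemma null_sets_not_generic:
  fixes S :: "'n::finite \<Rightarrow> 's::finite set"
  shows "\<exists>N\<in>null_sets (Pi\<^sub>M (UNIV \<times> profiles S) (\<lambda>_. lborel)). {U \<in> games S. \<not> generic S U} \<subseteq> N"
proof -
  let ?I = "(UNIV :: 'n set) \<times> profiles S"
  let ?M = "Pi\<^sub>M ?I (\<lambda>_. lborel) :: ('n, 's) game measure"
  define Graph where "Graph k F = {U \<in> space ?M. U k = F U}"
    for k and F :: "('n, 's) game \<Rightarrow> real"
  define F where "F i b b' a d e = (\<lambda>U :: ('n, 's) game. U (i, b(i := a)) +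
        (U (i, b(i := d)) - U (i, b(i := a))) * (U (i, b'(i := e)) - U (i, b'(i := a)))
          / (U (i, b'(i := d)) - U (i, b'(i := a))))" for i b b' a d e
  define N1 where "N1 = (\<Union>(i, b, a, d) \<in> {(i, b, a, d). b \<in> profiles_except S i \<and> a \<in> S i \<and> d \<in> S i \<and> a \<noteq> d}.
      Graph (i, b(i := a)) (\<lambda>U. U (i, b(i := d))))"
  define N2 where "N2 = (\<Union>(i, b, b', a, d, e) \<in> {(i, b, b', a, d, e). b \<in> profiles_except S i \<and>
      b' \<in> profiles_except S i \<and> a \<in> S i \<and> d \<in> S i \<and> e \<in> S i \<and> b \<noteq> b' \<and> a \<noteq> d \<and> a \<noteq> e \<and> d \<noteq> e}.
      Graph (i, b(i := e)) (F i b b' a d e))"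
  have fin: "finite ?I" by (rule finite)
  have coord: "(\<lambda>U. U (i, b(i := a))) \<in> borel_measurable ?M"
    if "b \<in> profiles_except S i" "a \<in> S i" for i b a
    using measurable_component_singleton[of "(i, b(i := a))" ?I "\<lambda>_. lborel"]
      fun_upd_profiles_except[OF that] by simp
  have upd: "b(i := a) \<noteq> b'(i := a')"
    if "b \<in> profiles_except S i" "b' \<in> profiles_except S i" "b \<noteq> b' \<or> a \<noteq> a'" for i b b' a a'
    using fun_upd_profiles_except_inject[OF that(1,2)] that(3) by (metis fun_upd_same)
  have "N1 \<in> null_sets ?M"
    unfolding N1_def Graph_def
  proof (intro null_sets_UN' countable_finite finite, clarify)
    fix i b a d
    assume "b \<in> profiles_except S i" "a \<in> S i" "d \<in> S i" "a \<noteq> d"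
    then show "{U \<in> space ?M. U (i, b(i := a)) = U (i, b(i := d))} \<in> null_sets ?M"
      by (intro null_sets_PiM_graph fin) (auto simp: coord fun_upd_profiles_except upd)
  qed
  moreover have "N2 \<in> null_sets ?M"
    unfolding N2_def Graph_def
  proof (intro null_sets_UN' countable_finite finite, clarify)
    fix i b b' a d e
    assume *: "b \<in> profiles_except S i" "b' \<in> profiles_except S i" "a \<in> S i" "d \<in> S i" "e \<in> S i"
      "b \<noteq> b'" "a \<noteq> d" "a \<noteq> e" "d \<noteq> e"
    have "F i b b' a d e \<in> borel_measurable ?M"
      unfolding F_def using * by (intro borel_measurable_add borel_measurable_divide
        borel_measurable_times borel_measurable_diff coord)
    moreover have "F i b b' a d e (U((i, b(i := e)) := t)) = F i b b' a d e U" for U t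
      using * upd by (auto simp: F_def)
    ultimately show "{U \<in> space ?M. U (i, b(i := e)) = F i b b' a d e U} \<in> null_sets ?M"
      using * by (intro null_sets_PiM_graph fin) (auto simp: fun_upd_profiles_except)
  qed
  ultimately have "N1 \<union> N2 \<in> null_sets ?M" by (rule null_sets.Un)
  moreover have "{U \<in> games S. \<not> generic S U} \<subseteq> N1 \<union> N2"
  proof
    fix U assume U: "U \<in> {U \<in> games S. \<not> generic S U}"
    then have "U \<in> space ?M" by (simp add: games_def space_PiM)
    from U consider (tie) i b a d where
        "b \<in> profiles_except S i" "a \<in> S i" "d \<in> S i" "a \<noteq> d" "U (i, b(i := a)) = U (i, b(i := d))"
      | (proportional) i b b' a d e where
        "b \<in> profiles_except S i" "b' \<in> profiles_except S i" "a \<in> S i" "d \<in> S i" "e \<in> S i"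
        "b \<noteq> b'" "a \<noteq> d" "a \<noteq> e" "d \<noteq> e" "U (i, b(i := e)) = F i b b' a d e U"
      unfolding generic_def F_def mem_Collect_eq by blast
    then show "U \<in> N1 \<union> N2"
    proof cases
      case tie
      then have "U \<in> Graph (i, b(i := a)) (\<lambda>U. U (i, b(i := d)))"
        using \<open>U \<in> space ?M\<close> by (simp add: Graph_def)
      then have "U \<in> N1" unfolding N1_def using tie by blast
      then show ?thesis by blast
    next
      case proportional
      then have "U \<in> Graph (i, b(i := e)) (F i b b' a d e)"
        using \<open>U \<in> space ?M\<close> by (simp add: Graph_def)
      then have "U \<in> N2" unfolding N2_def using proportional by blast
      then show ?thesis by blast
    qed
  qed
  ultimately show ?thesis by blast
qed

theorem proposition7:
  fixes m :: "'n::finite \<Rightarrow> nat" and S :: "'n \<Rightarrow> 's::finite set"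
  assumes "CARD('n) \<ge> 2"
    and "\<And>i. card (S i) = m i"
    and "\<And>i. (\<Prod>j\<in>UNIV - {i}. m j) \<ge> 2"
  shows "{U \<in> games S. aff_dim (correlated_equilibria S U) = int (\<Prod>i\<in>UNIV. m i) - 2}
           \<in> null_sets (game_lebesgue S)"
proof -
  have card: "card (profiles S) = (\<Prod>i\<in>UNIV. m i)"
    by (simp add: profiles_def card_PiE assms(2))
  have except: "card (profiles_except S i) = (\<Prod>j\<in>UNIV - {i}. m j)" for i
    by (simp add: profiles_except_def card_PiE assms(2))
  \<comment> \<open>Some other player has \<open>j\<close> among the opponents, whose product of strategy numbers is not 0.\<close>
  have pos: "m j \<ge> 1" for j
  proof -
    have "card (UNIV - {j}) \<noteq> 0" using assms(1) by (simp add: card_Diff_singleton)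
    then have "UNIV - {j} \<noteq> {}" by force
    then obtain i where "i \<noteq> j" by blast
    have "m j \<noteq> 0"
    proof
      assume "m j = 0"
      then have "(\<Prod>k\<in>UNIV - {i}. m k) = 0" using \<open>i \<noteq> j\<close> by (intro prod_zero bexI[of _ j]) auto
      then show False using assms(3)[of i] by linarith
    qed
    then show ?thesis by simp
  qed
  fix i :: 'n
  have "(\<Prod>i\<in>UNIV. m i) = m i * (\<Prod>j\<in>UNIV - {i}. m j)"
    by (simp add: prod.remove)
  also have "\<dots> \<ge> 1 * 2" using pos assms(3) by (rule mult_le_mono)
  finally have "aff_dim (correlated_equilibria S U) \<noteq> int (\<Prod>i\<in>UNIV. m i) - 2" if "generic S U" for U
    using generic_aff_dim[OF that] assms(3) by (simp add: card except)
  then have "{U \<in> games S. aff_dim (correlated_equilibria S U) = int (\<Prod>i\<in>UNIV. m i) - 2}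
      \<subseteq> {U \<in> games S. \<not> generic S U}"
    by blast
  with null_sets_not_generic[of S] obtain N where
    "N \<in> null_sets (Pi\<^sub>M (UNIV \<times> profiles S) (\<lambda>_. lborel))"
    "{U \<in> games S. aff_dim (correlated_equilibria S U) = int (\<Prod>i\<in>UNIV. m i) - 2} \<subseteq> N"
    by blast
  then show ?thesis
    unfolding game_lebesgue_def by (intro null_sets_completion_subset[OF _ null_sets_completionI])
qed

end
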